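(* Let $(S,s)$ be a finite bijective set-theoretic solution to the Pentagon Equation, with $s(x,y)=(x\cdot y,\theta_x(y))$ and $E=E(S,\cdot)$. Define the following equivalence relation on $S$: for $e,f\in E$ and $g,h\in G_1$, $e\cdot g\approx f\cdot h$ if $\theta_e=\theta_f$ and $g=h$. Let $\overline{S}=S/\approx$. Then $s$ induces a bijective set-theoretic solution $(\overline{S},\overline{s})$ to the Pentagon Equation; that is, the map $\overline{s}(\overline{x},\overline{y})=(\overline{x\cdot y},\overline{\theta_x(y)})$ on $\overline{S}\times\overline{S}$ (where $\overline{x}$ denotes the $\approx$-class of $x$) is well defined and is a bijective set-theoretic solution to the Pentagon Equation.
   Context: A set-theoretic solution to the Pentagon Equation is a pair $(S,s)$ with $S$ a nonempty set and $s:S\times S\to S\times S$ a map such that $s_{23}s_{13}s_{12}=s_{12}s_{23}$ on $S\times S\times S$, where $s_{12}=s\times\mathrm{id}$, $s_{23}=\mathrm{id}\times s$, $s_{13}=(\tau\times\mathrm{id})(\mathrm{id}\times s)(\tau\times\mathrm{id})$ and $\tau(x,y)=(y,x)$. It is finite if $S$ is finite, and bijective if $s$ is bijective. Writing $s(x,y)=(x\cdot y,\theta_x(y))$, $(S,\cdot)$ is a semigroup, and $E(S,\cdot)$ denotes its set of idempotents. For a finite bijective solution, $(S,\cdot)$ is a left group (isomorphic to $E\times G$ with $G$ a group and $(e,g)(f,h)=(e,gh)$). Fix $e_0\in E(S,\cdot)$, put $1=\theta_{e_0}(e_0)$, which is an idempotent of $(S,\cdot)$, and $G_1=1\cdot S$,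 which is a group under $\cdot$ with identity $1$. Every element of $S$ can be written uniquely as $e\cdot g$ with $e\in E(S,\cdot)$ and $g\in G_1$. The solution $(\overline S,\overline s)$ is called the retract of $(S,s)$. *)

theory Defs
  imports Main
begin

text \<open>Triples are nested to the right. Thus \<open>leg12 f\<close> is \<open>f \<times> id\<close> and \<open>leg23 f\<close> is
  \<open>id \<times> f\<close>; \<open>prod.swap\<close> is the flip \<open>\<tau>\<close>.\<close>

definition leg12 :: "('a \<times> 'a \<Rightarrow> 'a \<times> 'a) \<Rightarrow> 'a \<times> 'a \<times> 'a \<Rightarrow> 'a \<times> 'a \<times> 'a" where
  "leg12 f = (\<lambda>(x, y, z). (fst (f (x, y)), snd (f (x, y)), z))"

definition leg23 :: "('a \<times> 'a \<Rightarrow> 'a \<times> 'a) \<Rightarrow> 'a \<times> 'a \<times> 'a \<Rightarrow> 'a \<times> 'a \<times> 'a" where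
  "leg23 f = map_prod id f"

definition leg13 :: "('a \<times> 'a \<Rightarrow> 'a \<times> 'a) \<Rightarrow> 'a \<times> 'a \<times> 'a \<Rightarrow> 'a \<times> 'a \<times> 'a" where
  "leg13 f = leg12 prod.swap \<circ> leg23 f \<circ> leg12 prod.swap"

text \<open>The underlying set is an explicit carrier, so that the same notion applies to the quotient;
  the values of \<open>s\<close> outside \<open>S \<times> S\<close> are irrelevant.\<close>

definition pentagon_solution :: "'a set \<Rightarrow> ('a \<times> 'a \<Rightarrow> 'a \<times> 'a) \<Rightarrow> bool" where
  "pentagon_solution S s \<longleftrightarrow>
     S \<noteq> {} \<and> s ` (S \<times> S) \<subseteq> S \<times> S \<and>
     (\<forall>t \<in> S \<times> S \<times> S. (leg23 s \<circ> leg13 s \<circ> leg12 s) t = (leg12 s \<circ> leg23 s) t)"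

definition bijective_pentagon_solution :: "'a set \<Rightarrow> ('a \<times> 'a \<Rightarrow> 'a \<times> 'a) \<Rightarrow> bool" where
  "bijective_pentagon_solution S s \<longleftrightarrow>
     pentagon_solution S s \<and> bij_betw s (S \<times> S) (S \<times> S)"

definition mult :: "('a \<times> 'a \<Rightarrow> 'a \<times> 'a) \<Rightarrow> 'a \<Rightarrow> 'a \<Rightarrow> 'a" where
  "mult s x y = fst (s (x, y))"

definition theta :: "('a \<times> 'a \<Rightarrow> 'a \<times> 'a) \<Rightarrow> 'a \<Rightarrow> 'a \<Rightarrow> 'a" where
  "theta s x y = snd (s (x, y))"

definition idempotents :: "'a set \<Rightarrow> ('a \<times> 'a \<Rightarrow> 'a \<times> 'a) \<Rightarrow> 'a set" where
  "idempotents S s = {e \<in> S. mult s e e = e}"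

text \<open>\<open>G1 S s e0\<close> is \<open>1 \<cdot> S\<close> for the idempotent \<open>1 = \<theta>\<^bsub>e0\<^esub>(e0)\<close>.\<close>

definition G1 :: "'a set \<Rightarrow> ('a \<times> 'a \<Rightarrow> 'a \<times> 'a) \<Rightarrow> 'a \<Rightarrow> 'a set" where
  "G1 S s e0 = mult s (theta s e0 e0) ` S"

text \<open>\<open>\<theta>\<^sub>e = \<theta>\<^sub>f\<close> is equality of maps on the carrier \<open>S\<close>.\<close>

definition retract_rel :: "'a set \<Rightarrow> ('a \<times> 'a \<Rightarrow> 'a \<times> 'a) \<Rightarrow> 'a \<Rightarrow> ('a \<times> 'a) set" where
  "retract_rel S s e0 =
     {(mult s e g, mult s f h) | e f g h.
        e \<in> idempotents S s \<and> f \<in> idempotents S s \<and> g \<in> G1 S s e0 \<and> h \<in> G1 S s e0 \<and>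
        (\<forall>y \<in> S. theta s e y = theta s f y) \<and> g = h}"

text \<open>The map induced by \<open>s\<close> on classes, in the usual union form: when \<open>r\<close> is an equivalence
  relation compatible with \<open>s\<close>, all sets in each union coincide.\<close>

definition induced_map ::
    "('a \<times> 'a) set \<Rightarrow> ('a \<times> 'a \<Rightarrow> 'a \<times> 'a) \<Rightarrow> 'a set \<times> 'a set \<Rightarrow> 'a set \<times> 'a set" where
  "induced_map r s = (\<lambda>(X, Y).
     (\<Union>x\<in>X. \<Union>y\<in>Y. r `` {mult s x y}, \<Union>x\<in>X. \<Union>y\<in>Y. r `` {theta s x y}))"

end

theory Submission
  imports Defs
begin

text \<open>Every \<open>u \<in> S\<close> has exactly \<open>card S\<close> factorisations \<open>u = x \<cdot> y\<close>, because \<open>s\<close> is bijective.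
  Counting the pairs whose product lies in a left ideal \<open>L\<close> then shows that \<open>x \<cdot> y \<in> L\<close> forces
  \<open>y \<in> L\<close>. Together with \<open>\<theta>\<^sub>x(y \<cdot> z) = \<theta>\<^sub>x(y) \<cdot> \<theta>\<^bsub>x\<cdot>y\<^esub>(z)\<close> this makes \<open>\<theta>\<^sub>e(e)\<close> a right identity for
  every idempotent \<open>e\<close>, and the left group structure follows. Next, each \<open>\<theta>\<^sub>e\<close> with \<open>e\<close> idempotent
  permutes the idempotents and is onto \<open>S\<close>, from which all \<open>\<theta>\<^sub>x\<close> are bijective. The identity
  \<open>\<theta>\<^bsub>\<theta>x(y)\<^esub> \<circ> \<theta>\<^bsub>x\<cdot>y\<^esub> = \<theta>\<^sub>y\<close> can therefore be cancelled on either side, which gives the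
  compatibility of the relation with \<open>s\<close>; bijectivity passes to the finite quotient because
  surjectivity does.\<close>

locale finite_bijective_pentagon =
  fixes S :: "'a set" and s :: "'a \<times> 'a \<Rightarrow> 'a \<times> 'a"
  assumes finite_S: "finite S"
    and bijective: "bijective_pentagon_solution S s"
begin

abbreviation prd :: "'a \<Rightarrow> 'a \<Rightarrow> 'a" (infixl "\<cdot>" 70) where "x \<cdot> y \<equiv> mult s x y"
abbreviation th :: "'a \<Rightarrow> 'a \<Rightarrow> 'a" ("\<theta>") where "\<theta> \<equiv> theta s"
abbreviation E :: "'a set" where "E \<equiv> idempotents S s"

lemma s_eq: "s (x, y) = (x \<cdot> y, \<theta> x y)"
  by (simp add: mult_def theta_def)

lemma bij_s: "bij_betw s (S \<times> S) (S \<times> S)"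
  using bijective by (simp add: bijective_pentagon_solution_def)

lemma closed [simp]:
  assumes "x \<in> S" "y \<in> S"
  shows "x \<cdot> y \<in> S" "\<theta> x y \<in> S"
  using bij_betwE[OF bij_s] assms by (fastforce simp: s_eq)+

text \<open>The three equations are the three components of the pentagon identity at
  \<open>(x, y, z)\<close>.\<close>

lemma pentagon:
  assumes "x \<in> S" "y \<in> S" "z \<in> S"
  shows assoc: "x \<cdot> y \<cdot> z = x \<cdot> (y \<cdot> z)"
    and theta_mult: "\<theta> x (y \<cdot> z) = \<theta> x y \<cdot> \<theta> (x \<cdot> y) z"
    and theta_theta: "\<theta> (\<theta> x y) (\<theta> (x \<cdot> y) z) = \<theta> y z"
proof -
  have "(leg23 s \<circ> leg13 s \<circ> leg12 s) (x, y, z) = (leg12 s \<circ> leg23 s) (x, y, z)"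
    using bijective assms unfolding bijective_pentagon_solution_def pentagon_solution_def by blast
  then show "x \<cdot> y \<cdot> z = x \<cdot> (y \<cdot> z)" "\<theta> x (y \<cdot> z) = \<theta> x y \<cdot> \<theta> (x \<cdot> y) z"
    "\<theta> (\<theta> x y) (\<theta> (x \<cdot> y) z) = \<theta> y z"
    by (simp_all add: leg12_def leg13_def leg23_def s_eq)
qed

section \<open>Bijectivity of \<open>s\<close>, left ideals and the left group structure\<close>

lemma s_inject:
  assumes "x \<in> S" "y \<in> S" "x' \<in> S" "y' \<in> S" "x \<cdot> y = x' \<cdot> y'" "\<theta> x y = \<theta> x' y'"
  shows "x = x' \<and> y = y'"
  using inj_onD[OF bij_betw_imp_inj_on[OF bij_s], of "(x, y)" "(x', y')"] assms
  by (simp add: s_eq)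

lemma s_surj:
  assumes "u \<in> S" "v \<in> S"
  obtains x y where "x \<in> S" "y \<in> S" "x \<cdot> y = u" "\<theta> x y = v"
proof -
  have "(u, v) \<in> s ` (S \<times> S)"
    using bij_betw_imp_surj_on[OF bij_s] assms by simp
  then show thesis
    using that by (auto simp: s_eq)
qed

text \<open>Since \<open>L\<close> is a left ideal, \<open>s\<close> maps
  \<open>S \<times> L\<close> injectively into \<open>L \<times> S\<close>, a finite set of the same
  size, hence onto it. A pair with product in \<open>L\<close> is sent into
  \<open>L \<times> S\<close>, so by injectivity it already lies in
  \<open>S \<times> L\<close>.\<close>

lemma left_ideal_factor:
  assumes "L \<subseteq> S" and ideal: "\<And>x y. x \<in> S \<Longrightarrow> y \<in> L \<Longrightarrow> x \<cdot> y \<in> L"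
    and "x \<in> S" "y \<in> S" "x \<cdot> y \<in> L"
  shows "y \<in> L"
proof -
  have sub: "S \<times> L \<subseteq> S \<times> S"
    using \<open>L \<subseteq> S\<close> by auto
  have inj: "inj_on s (S \<times> S)"
    using bij_s by (rule bij_betw_imp_inj_on)
  have fin: "finite (L \<times> S)"
    using finite_S \<open>L \<subseteq> S\<close> by (simp add: finite_subset)
  have "s ` (S \<times> L) \<subseteq> L \<times> S"
    using \<open>L \<subseteq> S\<close> ideal by (auto simp: s_eq)
  moreover have "card (s ` (S \<times> L)) = card (L \<times> S)"
    using inj_on_subset[OF inj sub] by (simp add: card_image card_cartesian_product)
  ultimately have "s ` (S \<times> L) = L \<times> S"
    using fin by (simp add: card_subset_eq)
  then have "s (x, y) \<in> s ` (S \<times> L)"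
    using assms(3-5) by (simp add: s_eq)
  then show ?thesis
    using inj_on_image_mem_iff[OF inj _ sub, of "(x, y)"] assms(3,4) by simp
qed

lemma principal_left_ideal_factor:
  assumes "x \<in> S" "y \<in> S" "z \<in> S" "x \<cdot> y \<in> (\<lambda>w. w \<cdot> z) ` S"
  shows "y \<in> (\<lambda>w. w \<cdot> z) ` S"
proof (rule left_ideal_factor[OF _ _ assms(1,2,4)])
  show "(\<lambda>w. w \<cdot> z) ` S \<subseteq> S"
    using assms by auto
  show "a \<cdot> b \<in> (\<lambda>w. w \<cdot> z) ` S" if "a \<in> S" "b \<in> (\<lambda>w. w \<cdot> z) ` S" for a b
    using that assms by (auto simp: assoc[symmetric] intro!: image_eqI)
qed

lemma E_I: "e \<in> S \<Longrightarrow> e \<cdot> e = e \<Longrightarrow> e \<in> E"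
  and E_subset: "e \<in> E \<Longrightarrow> e \<in> S"
  and E_idem: "e \<in> E \<Longrightarrow> e \<cdot> e = e"
  by (simp_all add: idempotents_def)

declare E_subset [simp] E_idem [simp]

lemma theta_idem_right_identity:
  assumes "e \<in> E" "v \<in> S"
  shows "v \<cdot> \<theta> e e = v"
proof -
  \<comment> \<open>With \<open>(x, y)\<close> the preimage of \<open>(e, v)\<close>, the product
    \<open>e = e \<cdot> e\<close> lies in the left ideal of multiples of \<open>e\<close>, hence so
    does \<open>y\<close>. Expanding \<open>\<theta> x (y \<cdot> e) = \<theta> x y\<close> then
    yields the claim.\<close>
  obtain x y where xy: "x \<in> S" "y \<in> S" "x \<cdot> y = e" "\<theta> x y = v"
    using s_surj[of e v] assms by auto
  have "x \<cdot> y \<in> (\<lambda>z. z \<cdot> e) ` S"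
    using xy(3) E_idem[OF assms(1)] E_subset[OF assms(1)] by (metis image_eqI)
  then have "y \<in> (\<lambda>z. z \<cdot> e) ` S"
    using principal_left_ideal_factor[of x y e] xy(1,2) assms by simp
  then have "y \<cdot> e = y"
    using assms by (auto simp: assoc)
  then show ?thesis
    using theta_mult[of x y e] xy assms by simp
qed

lemma right_mult_surj:
  assumes "e0 \<in> E" "z \<in> S"
  shows "(\<lambda>x. x \<cdot> z) ` S = S"
proof -
  let ?L = "(\<lambda>x. x \<cdot> z) ` S"
  have e0: "\<theta> e0 e0 \<in> S" "x \<cdot> \<theta> e0 e0 = x" if "x \<in> S" for x
    using theta_idem_right_identity assms that by simp_all
  have "z \<in> ?L"
    using principal_left_ideal_factor[of z z z] assms by simp
  \<comment> \<open>Here \<open>z \<cdot> \<theta> e0 e0 = z\<close> lies in \<open>?L\<close>. A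
    left ideal that contains a right identity is all of \<open>S\<close>.\<close>
  then have "\<theta> e0 e0 \<in> ?L"
    using principal_left_ideal_factor[of z "\<theta> e0 e0" z] e0 assms by simp
  then obtain y where y: "y \<in> S" "\<theta> e0 e0 = y \<cdot> z"
    by auto
  have "x = x \<cdot> y \<cdot> z" if "x \<in> S" for x
    using e0[OF that] y that assms by (simp add: assoc)
  then show ?thesis
    using y(1) assms by (auto intro!: image_eqI)
qed

lemma right_cancel:
  assumes "e0 \<in> E" "x \<in> S" "y \<in> S" "z \<in> S" "x \<cdot> z = y \<cdot> z"
  shows "x = y"
  using eq_card_imp_inj_on[OF finite_S, of "\<lambda>x. x \<cdot> z"] right_mult_surj[of e0 z] assms
  by (auto dest: inj_onD)

text \<open>Both sides become \<open>x \<cdot> e\<close> after right multiplication by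
  \<open>e\<close>, which can be cancelled.\<close>

lemma idem_right_identity:
  assumes "e \<in> E" "x \<in> S"
  shows "x \<cdot> e = x"
  using right_cancel[of e "x \<cdot> e" x e] assms by (simp add: assoc)

lemma idem_absorb:
  assumes "e \<in> E" "x \<in> S" "y \<in> S"
  shows "x \<cdot> (e \<cdot> y) = x \<cdot> y"
  using assoc[of x e y] idem_right_identity[of e x] assms by simp

section \<open>The maps \<open>\<theta> x\<close>: action on idempotents and bijectivity\<close>

lemma theta_E:
  assumes "e \<in> E" "x \<in> S"
  shows "\<theta> x e \<in> E"
proof -
  have "\<theta> x e \<cdot> \<theta> x e = \<theta> x e"
    using theta_mult[of x e e] assms by (simp add: idem_right_identity)
  then show ?thesis
    using assms by (intro E_I) simp_all
qed

lemma theta_E_mult: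
  assumes "e \<in> E" "x \<in> S" "y \<in> S"
  shows "\<theta> x (e \<cdot> y) = \<theta> x e \<cdot> \<theta> x y"
  using theta_mult[of x e y] assms by (simp add: idem_right_identity)

lemma theta_image_E:
  assumes "x \<in> S"
  shows "\<theta> x ` E = E"
proof (rule endo_inj_surj)
  show "finite E"
    using finite_S by (rule rev_finite_subset) auto
  show "\<theta> x ` E \<subseteq> E"
    using theta_E assms by blast
  show "inj_on (\<theta> x) E"
  proof (rule inj_onI)
    fix e f assume "e \<in> E" "f \<in> E" "\<theta> x e = \<theta> x f"
    \<comment> \<open>As \<open>x \<cdot> e = x = x \<cdot> f\<close>, the values of
      \<open>s\<close> at \<open>(x, e)\<close> and \<open>(x, f)\<close> agree in both
      components.\<close>
    then show "e = f"
      using s_inject[of x e x f] assms by (simp add: idem_right_identity)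
  qed
qed

text \<open>Solvability of \<open>e \<cdot> x = x\<close> comes from surjectivity of right
  multiplication; cancelling \<open>x\<close> on the right gives both idempotency and
  uniqueness.\<close>

lemma left_unit_ex1:
  assumes "e0 \<in> E" "x \<in> S"
  shows "\<exists>!e. e \<in> E \<and> e \<cdot> x = x"
proof -
  obtain e where e: "e \<in> S" "e \<cdot> x = x"
    using right_mult_surj[OF assms] assms by (metis imageE)
  then have "e \<cdot> e = e"
    using right_cancel[of e0 "e \<cdot> e" e x] assms by (simp add: assoc)
  with e have "e \<in> E"
    by (intro E_I)
  show ?thesis
  proof (rule ex1I[of _ e])
    show "e \<in> E \<and> e \<cdot> x = x"
      using \<open>e \<in> E\<close> e(2) by simp
    show "f = e" if "f \<in> E \<and> f \<cdot> x = x" for f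
      using right_cancel[OF assms(1), of f e x] that e assms(2) by simp
  qed
qed

text \<open>In the left group \<open>E \<times> G\<close> this is the projection to the factor
  \<open>E\<close>.\<close>

definition left_unit :: "'a \<Rightarrow> 'a" where
  "left_unit x = (THE e. e \<in> E \<and> e \<cdot> x = x)"

lemma left_unit:
  assumes "e0 \<in> E" "x \<in> S"
  shows "left_unit x \<in> E" "left_unit x \<cdot> x = x"
  using theI'[OF left_unit_ex1[OF assms]] by (simp_all add: left_unit_def)

lemma left_unit_eqI:
  assumes "e \<in> E" "x \<in> S" "e \<cdot> x = x"
  shows "left_unit x = e"
  using left_unit_ex1[of e x] left_unit[of e x] assms by blast

lemma left_unit_mult:
  assumes "e0 \<in> E" "x \<in> S" "y \<in> S"
  shows "left_unit (x \<cdot> y) = left_unit x"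
  using left_unit[of e0 x] assms by (intro left_unit_eqI) (simp_all add: assoc[symmetric])

lemma left_unit_idem: "e \<in> E \<Longrightarrow> left_unit e = e"
  by (rule left_unit_eqI) auto

text \<open>First some \<open>y\<close> is found with
  \<open>\<theta> e y = \<theta> e e \<cdot> v\<close>, which is \<open>v\<close> up to its
  idempotent factor. That factor is then corrected by passing to \<open>b \<cdot> y\<close>, because
  \<open>\<theta> e\<close> permutes \<open>E\<close>.\<close>

lemma theta_idem_surj:
  assumes e: "e \<in> E"
  shows "\<theta> e ` S = S"
proof
  show "\<theta> e ` S \<subseteq> S"
    using e by auto
  show "S \<subseteq> \<theta> e ` S"
  proof
    fix v assume v: "v \<in> S"
    define a where "a = left_unit v"
    have a: "a \<in> E" "a \<cdot> v = v"
      using left_unit[OF e v] by (simp_all add: a_def)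
    \<comment> \<open>\<open>w\<close> is an inverse of \<open>v\<close> up to idempotents; it is
      realized as \<open>\<theta> y z\<close> in order to control
      \<open>\<theta> e y\<close>.\<close>
    obtain w where w: "w \<in> S" "w \<cdot> v = e"
      using right_mult_surj[OF e v] E_subset[OF e] by (metis imageE)
    obtain y z where yz: "y \<in> S" "z \<in> S" "y \<cdot> z = e" "\<theta> y z = w"
      using s_surj[of e w] w e by auto
    have "left_unit y = e"
      using left_unit_mult[OF e yz(1,2)] left_unit_idem[OF e] yz(3) by simp
    then have ey: "e \<cdot> y = y"
      using left_unit[OF e yz(1)] by simp
    \<comment> \<open>This expands \<open>\<theta> e (y \<cdot> z)\<close>, using
      \<open>e \<cdot> y = y\<close> and \<open>\<theta> y z = w\<close>.\<close>
    have y: "\<theta> e y \<cdot> w = \<theta> e e"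
      using theta_mult[of e y z] ey e yz by simp
    have "\<theta> e y = \<theta> e y \<cdot> (w \<cdot> v)"
      using w e yz(1) by (simp add: idem_right_identity)
    also have "\<dots> = \<theta> e e \<cdot> v"
      using assoc[of "\<theta> e y" w v] y w(1) v e yz(1) by simp
    finally have y': "\<theta> e y = \<theta> e e \<cdot> v" .
    obtain b where b: "b \<in> E" "\<theta> e b = a"
      using theta_image_E[of e] a(1) e by (metis E_subset imageE)
    have "\<theta> e (b \<cdot> y) = a \<cdot> \<theta> e e \<cdot> v"
      using theta_E_mult[of b e y] b y' yz(1) e v a by (simp add: assoc)
    also have "\<dots> = v"
      using theta_idem_right_identity[of e a] e a by simp
    finally show "v \<in> \<theta> e ` S"
      using b yz(1) by (metis E_subset closed(1) image_eqI)
  qed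
qed

text \<open>For \<open>e = left_unit x\<close> one has
  \<open>\<theta> e (x \<cdot> y) = \<theta> e x \<cdot> \<theta> x y\<close>, so
  \<open>\<theta> x y\<close> determines \<open>x \<cdot> y\<close> by injectivity of
  \<open>\<theta> e\<close>; then \<open>s\<close> is injective.\<close>

lemma theta_inj:
  assumes "e0 \<in> E" "x \<in> S" "y \<in> S" "z \<in> S" "\<theta> x y = \<theta> x z"
  shows "y = z"
proof -
  define e where "e = left_unit x"
  have e: "e \<in> E" "e \<cdot> x = x"
    using left_unit[of e0 x] assms by (simp_all add: e_def)
  have "inj_on (\<theta> e) S"
    using eq_card_imp_inj_on[OF finite_S] theta_idem_surj[OF e(1)] by metis
  moreover have "\<theta> e (x \<cdot> y) = \<theta> e (x \<cdot> z)"
    using theta_mult[of e x] e assms by simp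
  ultimately have "x \<cdot> y = x \<cdot> z"
    using assms by (simp add: inj_on_eq_iff)
  then show ?thesis
    using s_inject[of x y x z] assms by simp
qed

lemma theta_surj:
  assumes "e0 \<in> E" "x \<in> S"
  shows "\<theta> x ` S = S"
proof (rule endo_inj_surj[OF finite_S])
  show "\<theta> x ` S \<subseteq> S"
    using assms by auto
  show "inj_on (\<theta> x) S"
    using theta_inj[OF assms] by (rule inj_onI)
qed

section \<open>The retract relation and its compatibility with \<open>s\<close>\<close>

lemma retract_rel_iff:
  assumes "e0 \<in> E"
  shows "(x, y) \<in> retract_rel S s e0 \<longleftrightarrow> x \<in> S \<and> y \<in> S \<and> e0 \<cdot> x = e0 \<cdot> y \<and>
     (\<forall>z\<in>S. \<theta> (left_unit x) z = \<theta> (left_unit y) z)" (is "_ \<longleftrightarrow> ?R")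
proof
  \<comment> \<open>\<open>u\<close> is the identity 1 of \<open>G1 S s e0\<close>, and the factors
    of \<open>x\<close> are \<open>left_unit x\<close> and \<open>u \<cdot> x\<close>. Comparing
    \<open>e0 \<cdot> x\<close> instead of \<open>u \<cdot> x\<close> is equivalent, since
    idempotents are absorbed inside products.\<close>
  define u where "u = \<theta> e0 e0"
  have u: "u \<in> E"
    using theta_E[of e0 e0] assms by (simp add: u_def)
  assume "(x, y) \<in> retract_rel S s e0"
  then obtain e f g where "e \<in> E" "f \<in> E" "\<forall>z\<in>S. \<theta> e z = \<theta> f z"
      "x = e \<cdot> g" "y = f \<cdot> g" and g: "g \<in> G1 S s e0"
    unfolding retract_rel_def by blast
  moreover obtain a where "a \<in> S" "g = u \<cdot> a"
    using g unfolding G1_def u_def by (rule imageE)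
  ultimately have *: "e \<in> E" "f \<in> E" "a \<in> S" "\<forall>z\<in>S. \<theta> e z = \<theta> f z"
      "x = e \<cdot> (u \<cdot> a)" "y = f \<cdot> (u \<cdot> a)"
    by simp_all
  have "left_unit x = e" "left_unit y = f"
    using * u by (auto intro!: left_unit_eqI simp: assoc[symmetric])
  moreover have "e0 \<cdot> x = e0 \<cdot> y"
    using * u assms by (simp add: idem_absorb)
  ultimately show ?R
    using * u by simp
next
  define u where "u = \<theta> e0 e0"
  have u: "u \<in> E"
    using theta_E[of e0 e0] assms by (simp add: u_def)
  assume R: ?R
  have dec: "x = left_unit x \<cdot> (u \<cdot> x)" if "x \<in> S" for x
    using left_unit[OF assms that] u that by (simp add: idem_absorb)
  have "u \<cdot> x = u \<cdot> (e0 \<cdot> x)" if "x \<in> S" for x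
    using that assms u by (simp add: idem_absorb)
  then have "u \<cdot> x = u \<cdot> y"
    using R by metis
  moreover have "u \<cdot> x \<in> G1 S s e0" "u \<cdot> y \<in> G1 S s e0"
    using R by (auto simp: G1_def u_def)
  ultimately have "(x, y) = (left_unit x \<cdot> (u \<cdot> x), left_unit y \<cdot> (u \<cdot> y)) \<and>
      left_unit x \<in> E \<and> left_unit y \<in> E \<and> u \<cdot> x \<in> G1 S s e0 \<and> u \<cdot> y \<in> G1 S s e0 \<and>
      (\<forall>z\<in>S. \<theta> (left_unit x) z = \<theta> (left_unit y) z) \<and> u \<cdot> x = u \<cdot> y"
    using dec[of x] dec[of y] left_unit(1)[OF assms] R by auto
  then show "(x, y) \<in> retract_rel S s e0"
    unfolding retract_rel_def mem_Collect_eq by (intro exI)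
qed

lemma equiv_retract_rel:
  assumes "e0 \<in> E"
  shows "equiv S (retract_rel S s e0)"
  by (intro equivI refl_onI symI transI subrelI) (auto simp: retract_rel_iff[OF assms])

text \<open>Write \<open>x = e \<cdot> g\<close> and \<open>y = f \<cdot> g\<close>. Composing
  \<open>\<theta> x\<close> with \<open>\<theta> (\<theta> e g)\<close>, and
  \<open>\<theta> y\<close> with \<open>\<theta> (\<theta> f g)\<close>, gives
  \<open>\<theta> g\<close> both times; the outer maps coincide and are injective.\<close>

lemma retract_rel_theta_eq:
  assumes e0: "e0 \<in> E" and xy: "(x, y) \<in> retract_rel S s e0" and z: "z \<in> S"
  shows "\<theta> x z = \<theta> y z"
proof -
  note R = xy[unfolded retract_rel_iff[OF e0]]
  define e f g where "e = left_unit x" and "f = left_unit y" and "g = e0 \<cdot> x"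
  have e: "e \<in> E" "e \<cdot> x = x" and f: "f \<in> E" "f \<cdot> y = y"
    using left_unit[OF e0] R by (simp_all add: e_def f_def)
  have g: "g \<in> S" "e \<cdot> g = x"
    using R e idem_absorb[OF e0, of e x] e0 by (simp_all add: g_def)
  have g': "f \<cdot> g = y"
    using R f idem_absorb[OF e0, of f y] by (simp add: g_def)
  have "\<theta> e g = \<theta> f g"
    using R g(1) by (simp add: e_def f_def)
  then have "\<theta> (\<theta> e g) (\<theta> x z) = \<theta> (\<theta> e g) (\<theta> y z)"
    using theta_theta[of e g z] theta_theta[of f g z] e(1) f(1) g g' z by simp
  then show ?thesis
    using theta_inj[OF e0, of "\<theta> e g" "\<theta> x z" "\<theta> y z"] e(1) g(1) R z by simp
qed

lemma retract_rel_mult: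
  assumes e0: "e0 \<in> E"
    and "(x, x') \<in> retract_rel S s e0" "(y, y') \<in> retract_rel S s e0"
  shows "(x \<cdot> y, x' \<cdot> y') \<in> retract_rel S s e0"
proof -
  note R = assms(2,3)[unfolded retract_rel_iff[OF e0]]
  \<comment> \<open>Left multiplication by \<open>e0\<close> is an endomorphism of the
    semigroup.\<close>
  have split: "e0 \<cdot> (a \<cdot> b) = e0 \<cdot> a \<cdot> (e0 \<cdot> b)" if "a \<in> S" "b \<in> S" for a b
    using that e0 by (simp add: assoc idem_absorb)
  have "e0 \<cdot> (x \<cdot> y) = e0 \<cdot> (x' \<cdot> y')"
    using split[of x y] split[of x' y'] R by simp
  then show ?thesis
    using R left_unit_mult[OF e0] by (simp add: retract_rel_iff[OF e0])
qed

text \<open>An idempotent left factor \<open>e\<close> of \<open>y\<close> contributes the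
  idempotent left factor \<open>\<theta> x e\<close> to \<open>\<theta> x y\<close>, and
  multiplication by \<open>e0\<close> on the left absorbs it.\<close>

lemma theta_left_unit:
  assumes e0: "e0 \<in> E" and "x \<in> S" "y \<in> S"
  shows "left_unit (\<theta> x y) = \<theta> x (left_unit y)"
    and "e0 \<cdot> \<theta> x y = e0 \<cdot> \<theta> x (e0 \<cdot> y)"
proof -
  have e: "left_unit y \<in> E" "left_unit y \<cdot> y = y"
    using left_unit[OF e0] assms by simp_all
  have t: "\<theta> x (left_unit y) \<in> E"
    using theta_E e assms by simp
  have "\<theta> x y = \<theta> x (left_unit y) \<cdot> \<theta> x y"
    using theta_E_mult[of "left_unit y" x y] e assms by simp
  then show "left_unit (\<theta> x y) = \<theta> x (left_unit y)"
    using t assms by (intro left_unit_eqI) simp_all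
  show "e0 \<cdot> \<theta> x y = e0 \<cdot> \<theta> x (e0 \<cdot> y)"
    using theta_E_mult[of e0 x y] theta_E[of e0 x] assms
    by (simp add: idem_absorb)
qed

lemma retract_rel_theta:
  assumes e0: "e0 \<in> E"
    and "(x, x') \<in> retract_rel S s e0" "(y, y') \<in> retract_rel S s e0"
  shows "(\<theta> x y, \<theta> x' y') \<in> retract_rel S s e0"
proof -
  note R = assms(2,3)[unfolded retract_rel_iff[OF e0]]
  have eq: "\<theta> x' y' = \<theta> x y'"
    using retract_rel_theta_eq[OF e0 assms(2)] R by simp
  define e f where "e = left_unit y" and "f = left_unit y'"
  have e: "e \<in> E" and f: "f \<in> E"
    using left_unit[OF e0] R by (simp_all add: e_def f_def)
  \<comment> \<open>Since \<open>x \<cdot> e = x\<close>, the composite of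
    \<open>\<theta> (\<theta> x e)\<close> after \<open>\<theta> x\<close> is
    \<open>\<theta> e\<close>, and likewise for \<open>f\<close>. Surjectivity of
    \<open>\<theta> x\<close> allows its cancellation on the right.\<close>
  have "\<theta> (\<theta> x e) z = \<theta> (\<theta> x f) z" if z: "z \<in> S" for z
  proof -
    obtain w where w: "w \<in> S" "\<theta> x w = z"
      using theta_surj[OF e0, of x] R z by (metis imageE)
    have "\<theta> (\<theta> x e) z = \<theta> e w" "\<theta> (\<theta> x f) z = \<theta> f w"
      using theta_theta[of x e w] theta_theta[of x f w] e f w R by (simp_all add: idem_right_identity)
    then show ?thesis
      using R w(1) by (simp add: e_def f_def)
  qed
  moreover have "e0 \<cdot> \<theta> x y = e0 \<cdot> \<theta> x y'"
    using theta_left_unit(2)[OF e0, of x] R by metis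
  ultimately show ?thesis
    using R theta_left_unit(1)[OF e0] unfolding eq
    by (simp add: retract_rel_iff[OF e0] e_def f_def)
qed

end

section \<open>Passage to the quotient\<close>

lemma induced_map_class:
  assumes "equiv S r"
    and "\<And>x x' y y'. (x, x') \<in> r \<Longrightarrow> (y, y') \<in> r \<Longrightarrow> (mult s x y, mult s x' y') \<in> r"
    and "\<And>x x' y y'. (x, x') \<in> r \<Longrightarrow> (y, y') \<in> r \<Longrightarrow> (theta s x y, theta s x' y') \<in> r"
    and "x \<in> S" "y \<in> S"
  shows "induced_map r s (r `` {x}, r `` {y}) = (r `` {mult s x y}, r `` {theta s x y})"
proof -
  have "r `` {mult s x' y'} = r `` {mult s x y}" "r `` {theta s x' y'} = r `` {theta s x y}"
    if "x' \<in> r `` {x}" "y' \<in> r `` {y}" for x' y'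
    using that assms(2,3) equiv_class_eq[OF assms(1)] by (metis Image_singleton_iff)+
  \<comment> \<open>The unions collapse to their constant value only over nonempty index
    sets.\<close>
  moreover have "r `` {x} \<noteq> {}" "r `` {y} \<noteq> {}"
    using equiv_class_self[OF assms(1)] assms(4,5) by blast+
  ultimately show ?thesis
    unfolding induced_map_def prod.case prod.inject by (intro conjI SUP_eq_const)
qed

text \<open>The pentagon identity is checked on representatives, and preimages under
  \<open>s\<close> of representatives give surjectivity. On the finite quotient, surjectivity
  implies injectivity.\<close>

lemma bijective_pentagon_solution_quotient:
  assumes "finite S" and sol: "bijective_pentagon_solution S s" and eq: "equiv S r"
    and induced: "\<And>x y. x \<in> S \<Longrightarrow> y \<in> S \<Longrightarrow>
      s' (r `` {x}, r `` {y}) = (r `` {mult s x y}, r `` {theta s x y})"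
  shows "bijective_pentagon_solution (S // r) s'"
proof -
  interpret finite_bijective_pentagon S s
    using assms(1) sol by unfold_locales
  let ?Q = "S // r"
  have surj: "s' ` (?Q \<times> ?Q) = ?Q \<times> ?Q"
  proof
    show "s' ` (?Q \<times> ?Q) \<subseteq> ?Q \<times> ?Q"
      by (auto elim!: quotientE simp: induced intro!: quotientI)
    show "?Q \<times> ?Q \<subseteq> s' ` (?Q \<times> ?Q)"
    proof clarify
      fix U V assume "U \<in> ?Q" "V \<in> ?Q"
      then obtain u v where uv: "u \<in> S" "v \<in> S" "U = r `` {u}" "V = r `` {v}"
        by (auto elim!: quotientE)
      obtain x y where xy: "x \<in> S" "y \<in> S" "x \<cdot> y = u" "\<theta> x y = v"
        using s_surj uv(1,2) by blast
      then have "(U, V) = s' (r `` {x}, r `` {y})"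
        using uv by (simp add: induced)
      then show "(U, V) \<in> s' ` (?Q \<times> ?Q)"
        using xy by (auto intro!: quotientI)
    qed
  qed
  have "finite ?Q"
    using finite_quotient[OF \<open>finite S\<close> equiv_type[OF eq]] .
  then have "inj_on s' (?Q \<times> ?Q)"
    by (intro eq_card_imp_inj_on) (simp_all add: surj)
  moreover have "(leg23 s' \<circ> leg13 s' \<circ> leg12 s') t = (leg12 s' \<circ> leg23 s') t"
    if "t \<in> ?Q \<times> ?Q \<times> ?Q" for t
  proof -
    obtain x y z where "t = (r `` {x}, r `` {y}, r `` {z})" "x \<in> S" "y \<in> S" "z \<in> S"
      using \<open>t \<in> ?Q \<times> ?Q \<times> ?Q\<close> by (auto elim!: quotientE)
    then show ?thesis
      by (simp add: leg12_def leg13_def leg23_def induced assoc theta_mult theta_theta)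
  qed
  moreover have "?Q \<noteq> {}"
    using sol by (auto simp: bijective_pentagon_solution_def pentagon_solution_def quotient_def)
  ultimately show ?thesis
    by (simp add: bijective_pentagon_solution_def pentagon_solution_def bij_betw_def surj)
qed

theorem proposition3p4:
  fixes S :: "'a set" and s :: "'a \<times> 'a \<Rightarrow> 'a \<times> 'a" and e0 :: 'a
  defines "r \<equiv> retract_rel S s e0"
  assumes "finite S"
    and "bijective_pentagon_solution S s"
    and "e0 \<in> idempotents S s"
  shows "equiv S r
    \<and> (\<forall>x x' y y'. (x, x') \<in> r \<and> (y, y') \<in> r \<longrightarrow>
          (mult s x y, mult s x' y') \<in> r \<and> (theta s x y, theta s x' y') \<in> r)
    \<and> (\<forall>x\<in>S. \<forall>y\<in>S. induced_map r s (r `` {x}, r `` {y})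
          = (r `` {mult s x y}, r `` {theta s x y}))
    \<and> bijective_pentagon_solution (S // r) (induced_map r s)"
proof -
  interpret finite_bijective_pentagon S s
    using assms by unfold_locales
  note e0 = \<open>e0 \<in> idempotents S s\<close>
  have eq: "equiv S r"
    unfolding r_def using e0 by (rule equiv_retract_rel)
  have compat: "(mult s x y, mult s x' y') \<in> r" "(theta s x y, theta s x' y') \<in> r"
    if "(x, x') \<in> r" "(y, y') \<in> r" for x x' y y'
    using retract_rel_mult[OF e0] retract_rel_theta[OF e0] that by (simp_all add: r_def)
  have induced: "induced_map r s (r `` {x}, r `` {y}) = (r `` {mult s x y}, r `` {theta s x y})"
    if "x \<in> S" "y \<in> S" for x y
    using induced_map_class[OF eq compat that] .
  have "bijective_pentagon_solution (S // r) (induced_map r s)"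
    using bijective_pentagon_solution_quotient[OF finite_S bijective eq induced] .
  then show ?thesis
    using eq compat induced by blast
qed

end
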